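(* Let $N\subset\mathbb{R}^3$ be an open set with coordinates $(t,x,y)$ and metric $g_f^{\varepsilon}=\varepsilon\,dx^2+f(x,y)\,dy^2+2\,dt\,dy$ ($\varepsilon=\pm1$, $f$ smooth), with orthonormal frame $$e_1=\partial_x,\quad e_2=\tfrac{2-f}{2\sqrt2}\partial_t+\tfrac1{\sqrt2}\partial_y,\quad e_3=\tfrac{2+f}{2\sqrt2}\partial_t-\tfrac1{\sqrt2}\partial_y,$$ so that $\langle e_1,e_1\rangle=\varepsilon$, $\langle e_2,e_2\rangle=1$, $\langle e_3,e_3\rangle=-1$. Let $\Sigma\subset N$ be a non-degenerate totally umbilical surface with unit normal $\mathcal{V}=v_1e_1+v_2e_2+v_3e_3$, where $v_i\in C^\infty(\Sigma)$ and $\varepsilon v_1^2+v_2^2-v_3^2=\delta=\pm1$, and assume $v_1\neq0$ on $\Sigma$. Let $\lambda\in C^\infty(\Sigma)$ satisfy $-\overline{\nabla}_T\mathcal{V}=\lambda T$ for all $T\in T\Sigma$, and let $\nabla\lambda$ denote the gradient of $\lambda$ on $\Sigma$ with respect to the induced metric. Then $$\langle\nabla\lambda,e_1\rangle=\delta\frac{f_{xx}v_1(v_2-v_3)^2}{4},$$ $$\langle\nabla\lambda,e_2\rangle=\delta\frac{f_{xx}(v_3-v_2)}{4}\bigl(v_1^2+\varepsilon v_3(v_2-v_3)\bigr),$$ $$\langle\nabla\lambda,e_3\rangle=\delta\frac{f_{xx}(v_2-v_3)}{4}\bigl(v_1^2+\varepsilon v_2(v_2-v_3)\bigr).$$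
   Context: $\overline{\nabla}$ denotes the Levi-Civita connection of $g_f^{\varepsilon}$, and $\langle\cdot,\cdot\rangle$ denotes both $g_f^\varepsilon$ and the induced metric on $\Sigma$. A surface is non-degenerate if its induced metric is Riemannian or Lorentzian. *)

theory Defs
  imports "HOL-Analysis.Analysis"
begin

text \<open>Coordinates on R^3: index 1 = t, 2 = x, 3 = y. Surface patches are
  parametrised over open subsets of R^2.\<close>

text \<open>C^k and C^infinity via iterated Frechet derivatives.\<close>
fun Ck_on :: "nat \<Rightarrow> 'a::real_normed_vector set \<Rightarrow> ('a \<Rightarrow> 'b::real_normed_vector) \<Rightarrow> bool" where
  "Ck_on 0 U F = continuous_on U F"
| "Ck_on (Suc k) U F = (F differentiable_on U \<and>
      (\<forall>v. Ck_on k U (\<lambda>x. frechet_derivative F (at x) v)))"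

definition smooth_on :: "'a::real_normed_vector set \<Rightarrow> ('a \<Rightarrow> 'b::real_normed_vector) \<Rightarrow> bool" where
  "smooth_on U F \<longleftrightarrow> (\<forall>k. Ck_on k U F)"

text \<open>Partial derivative in the i-th coordinate direction.\<close>
definition pd :: "(real^'n \<Rightarrow> 'b::real_normed_vector) \<Rightarrow> real^'n \<Rightarrow> 'n \<Rightarrow> 'b" where
  "pd h p i = frechet_derivative h (at p) (axis i 1)"

text \<open>The function f(x,y) viewed on R^3.\<close>
definition fxy :: "(real^2 \<Rightarrow> real) \<Rightarrow> real^3 \<Rightarrow> real" where
  "fxy f p = f (vector [p$2, p$3])"

text \<open>Components of g_f^eps = eps dx^2 + f(x,y) dy^2 + 2 dt dy.\<close>
definition gcoef :: "real \<Rightarrow> (real^2 \<Rightarrow> real) \<Rightarrow> real^3 \<Rightarrow> 3 \<Rightarrow> 3 \<Rightarrow> real" where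
  "gcoef eps f p i j =
     (if i = 2 \<and> j = 2 then eps
      else if i = 3 \<and> j = 3 then fxy f p
      else if (i = 1 \<and> j = 3) \<or> (i = 3 \<and> j = 1) then 1
      else 0)"

definition gmat :: "real \<Rightarrow> (real^2 \<Rightarrow> real) \<Rightarrow> real^3 \<Rightarrow> real^3^3" where
  "gmat eps f p = (\<chi> i j. gcoef eps f p i j)"

definition ginner :: "real \<Rightarrow> (real^2 \<Rightarrow> real) \<Rightarrow> real^3 \<Rightarrow> real^3 \<Rightarrow> real^3 \<Rightarrow> real" where
  "ginner eps f p a b = (\<Sum>i\<in>UNIV. \<Sum>j\<in>UNIV. gcoef eps f p i j * a$i * b$j)"

text \<open>Christoffel symbols Gamma^k_{ij} of the Levi-Civita connection.\<close>
definition christoffel :: "real \<Rightarrow> (real^2 \<Rightarrow> real) \<Rightarrow> real^3 \<Rightarrow> 3 \<Rightarrow> 3 \<Rightarrow> 3 \<Rightarrow> real" where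
  "christoffel eps f p k i j =
     (1/2) * (\<Sum>l\<in>UNIV. matrix_inv (gmat eps f p) $ k $ l *
        (pd (\<lambda>q. gcoef eps f q j l) p i + pd (\<lambda>q. gcoef eps f q i l) p j
         - pd (\<lambda>q. gcoef eps f q i j) p l))"

text \<open>Levi-Civita covariant derivative (nabla-bar) of a vector field V along
  the patch X, in the direction of the tangent vector dX_q(w).\<close>
definition covd :: "real \<Rightarrow> (real^2 \<Rightarrow> real) \<Rightarrow> (real^2 \<Rightarrow> real^3) \<Rightarrow> (real^2 \<Rightarrow> real^3)
                    \<Rightarrow> real^2 \<Rightarrow> real^2 \<Rightarrow> real^3" where
  "covd eps f X V q w = frechet_derivative V (at q) w +
     (\<chi> k. \<Sum>i\<in>UNIV. \<Sum>j\<in>UNIV. christoffel eps f (X q) k i j *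
          (frechet_derivative X (at q) w)$i * (V q)$j)"

text \<open>The orthonormal frame (components in the basis d_t, d_x, d_y).\<close>
definition fe1 :: "real^3" where "fe1 = vector [0, 1, 0]"
definition fe2 :: "(real^2 \<Rightarrow> real) \<Rightarrow> real^3 \<Rightarrow> real^3" where
  "fe2 f p = vector [(2 - fxy f p) / (2 * sqrt 2), 0, 1 / sqrt 2]"
definition fe3 :: "(real^2 \<Rightarrow> real) \<Rightarrow> real^3 \<Rightarrow> real^3" where
  "fe3 f p = vector [(2 + fxy f p) / (2 * sqrt 2), 0, - 1 / sqrt 2]"

text \<open>Induced metric (first fundamental form) of the patch.\<close>
definition indmat :: "real \<Rightarrow> (real^2 \<Rightarrow> real) \<Rightarrow> (real^2 \<Rightarrow> real^3) \<Rightarrow> real^2 \<Rightarrow> real^2^2" where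
  "indmat eps f X q = (\<chi> a b. ginner eps f (X q) (pd X q a) (pd X q b))"

text \<open>Non-degenerate: induced metric Riemannian (positive definite) or
  Lorentzian (signature (+,-), i.e. negative determinant) -- 2x2 case.\<close>
definition nondegenerate_at :: "real \<Rightarrow> (real^2 \<Rightarrow> real) \<Rightarrow> (real^2 \<Rightarrow> real^3) \<Rightarrow> real^2 \<Rightarrow> bool" where
  "nondegenerate_at eps f X q \<longleftrightarrow>
     (indmat eps f X q $ 1 $ 1 > 0 \<and> det (indmat eps f X q) > 0) \<or> det (indmat eps f X q) < 0"

text \<open>Gradient on the surface w.r.t. the induced metric of a function lam (pulled back to U).\<close>
definition sgrad :: "real \<Rightarrow> (real^2 \<Rightarrow> real) \<Rightarrow> (real^2 \<Rightarrow> real^3) \<Rightarrow> (real^2 \<Rightarrow> real) \<Rightarrow> real^2 \<Rightarrow> real^3" where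
  "sgrad eps f X lam q = (\<Sum>a\<in>UNIV. \<Sum>b\<in>UNIV.
      (matrix_inv (indmat eps f X q) $ a $ b * pd lam q b) *\<^sub>R pd X q a)"

text \<open>f_xx as a function on R^3.\<close>
definition fxx :: "(real^2 \<Rightarrow> real) \<Rightarrow> real^3 \<Rightarrow> real" where
  "fxx f p = pd (\<lambda>r. pd (fxy f) r 2) p 2"

end

theory Submission
  imports Defs
begin

text \<open>
  Umbilicity says \<open>\<partial>\<^sub>a V = -\<lambda> X\<^sub>a - \<Gamma>(X\<^sub>a, V)\<close>, where \<open>\<Gamma>\<close> is the contracted
  Christoffel form of \<open>g\<^sub>f\<^sup>\<epsilon>\<close>. Equality of the mixed partials \<open>\<partial>\<^sub>1\<partial>\<^sub>2 V = \<partial>\<^sub>2\<partial>\<^sub>1 V\<close>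
  (and of \<open>\<partial>\<^sub>1\<partial>\<^sub>2 X\<close>) is the Codazzi equation; since \<open>f\<close> does not depend on \<open>t\<close>
  and \<open>f\<^sub>x\<^sub>y = f\<^sub>y\<^sub>x\<close>, everything but \<open>f\<^sub>x\<^sub>x\<close> cancels and it reads
  \<open>\<lambda>\<^sub>1 X\<^sub>2 - \<lambda>\<^sub>2 X\<^sub>1 = (f\<^sub>x\<^sub>x J / 2) (-V\<^sub>x, V\<^sub>y / \<epsilon>, 0)\<close> with \<open>J = dx \<and> dy (X\<^sub>1, X\<^sub>2)\<close>.
  Together with \<open>\<langle>V, X\<^sub>a\<rangle> = 0\<close> this forces \<open>d\<lambda> = c V\<^sub>y dy\<close> on the surface, \<open>c = -f\<^sub>x\<^sub>x / (2\<epsilon>)\<close>,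
  so \<open>\<nabla>\<lambda>\<close> is the tangential projection of the vector metrically dual to \<open>c V\<^sub>y dy\<close>:
  \<open>\<langle>\<nabla>\<lambda>, e\<rangle> = c V\<^sub>y (dy(e) - \<delta> V\<^sub>y \<langle>V, e\<rangle>)\<close>. Evaluating at \<open>e\<^sub>1, e\<^sub>2, e\<^sub>3\<close> gives the three formulas.
\<close>

section \<open>Symmetry of second derivatives\<close>

lemma norm_scaleR_add_le:
  fixes u v :: "'a::real_normed_vector"
  assumes "0 \<le> s" "s \<le> h" "0 \<le> t" "t \<le> h"
  shows "norm (s *\<^sub>R u + t *\<^sub>R v) \<le> h * norm u + h * norm v"
  using assms norm_triangle_le[of "s *\<^sub>R u" "t *\<^sub>R v"]
    mult_right_mono[of s h "norm u"] mult_right_mono[of t h "norm v"] by auto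

lemma second_difference_mean_value:
  fixes g :: "'a::real_normed_vector \<Rightarrow> real"
  assumes h: "0 < h" and hr: "h * norm u + h * norm v < r"
    and dg: "\<And>x. x \<in> ball q r \<Longrightarrow> g differentiable at x"
  shows "\<exists>s\<in>{0<..<h}. g (q + h *\<^sub>R u + h *\<^sub>R v) - g (q + h *\<^sub>R u) - g (q + h *\<^sub>R v) + g q
           = h * (frechet_derivative g (at (q + s *\<^sub>R u + h *\<^sub>R v)) u
                  - frechet_derivative g (at (q + s *\<^sub>R u + 0 *\<^sub>R v)) u)"
proof -
  define Gu where "Gu = (\<lambda>x. frechet_derivative g (at x) u)"
  define \<phi> where "\<phi> = (\<lambda>s. g (q + s *\<^sub>R u + h *\<^sub>R v) - g (q + s *\<^sub>R u + 0 *\<^sub>R v))"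
  define \<phi>' where "\<phi>' = (\<lambda>s r. r * (Gu (q + s *\<^sub>R u + h *\<^sub>R v) - Gu (q + s *\<^sub>R u + 0 *\<^sub>R v)))"
  have "(\<phi> has_derivative \<phi>' s) (at s within {0..h})" if s: "0 \<le> s" "s \<le> h" for s
  proof -
    have line: "((\<lambda>s. g (q + s *\<^sub>R u + t *\<^sub>R v)) has_derivative (\<lambda>r. r * Gu (q + s *\<^sub>R u + t *\<^sub>R v)))
        (at s within {0..h})" if t: "0 \<le> t" "t \<le> h" for t
    proof -
      have "dist q (q + s *\<^sub>R u + t *\<^sub>R v) = norm (s *\<^sub>R u + t *\<^sub>R v)"
        by (metis add.assoc add_diff_cancel_left' dist_commute dist_norm)
      then have "q + s *\<^sub>R u + t *\<^sub>R v \<in> ball q r"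
        using norm_scaleR_add_le[OF s t, of u v] hr by simp
      then have gd: "(g has_derivative frechet_derivative g (at (q + s *\<^sub>R u + t *\<^sub>R v)))
          (at (q + s *\<^sub>R u + t *\<^sub>R v))"
        using dg frechet_derivative_works by blast
      have "((\<lambda>s. q + s *\<^sub>R u + t *\<^sub>R v) has_derivative (\<lambda>r. r *\<^sub>R u)) (at s within {0..h})"
        by (auto intro!: derivative_eq_intros)
      from has_derivative_compose[OF this gd] show ?thesis
        using linear_scale[OF has_derivative_linear[OF gd]] by (simp add: o_def Gu_def)
    qed
    show ?thesis
      unfolding \<phi>_def \<phi>'_def using has_derivative_diff[OF line[of h] line[of 0]] h
      by (simp add: algebra_simps)
  qed
  then obtain s where s: "s \<in> {0<..<h}" and mv: "\<phi> h - \<phi> 0 = \<phi>' s (h - 0)"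
    using mvt_simple[of 0 h \<phi> \<phi>'] h by auto
  show ?thesis
    using mv by (intro bexI[OF _ s]) (simp add: \<phi>_def \<phi>'_def Gu_def algebra_simps)
qed

lemma linear_approx_difference:
  fixes G :: "'a::real_normed_vector \<Rightarrow> real"
  assumes L: "linear L"
    and approx: "\<And>y. norm (y - q) < d \<Longrightarrow> norm (G y - G q - L (y - q)) \<le> e * norm (y - q)"
    and y: "norm (y1 - q) < d" "norm (y2 - q) < d"
  shows "\<bar>G y1 - G y2 - L (y1 - y2)\<bar> \<le> e * norm (y1 - q) + e * norm (y2 - q)"
proof -
  have "L (y1 - y2) = L (y1 - q) - L (y2 - q)"
    using linear_diff[OF L, of "y1 - q" "y2 - q"] by simp
  then show ?thesis using approx[OF y(1)] approx[OF y(2)] by (simp add: abs_le_iff)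
qed

lemma second_difference_approx:
  fixes g :: "'a::real_normed_vector \<Rightarrow> real"
  assumes S: "open S" "q \<in> S" and dg: "\<And>x. x \<in> S \<Longrightarrow> g differentiable at x"
    and du: "(\<lambda>x. frechet_derivative g (at x) u) differentiable at q"
    and e: "e > 0"
  shows "\<exists>d>0. \<forall>h. 0 < h \<and> h < d \<longrightarrow>
     \<bar>(g (q + h *\<^sub>R u + h *\<^sub>R v) - g (q + h *\<^sub>R u) - g (q + h *\<^sub>R v) + g q)
       - h^2 * frechet_derivative (\<lambda>x. frechet_derivative g (at x) u) (at q) v\<bar>
       \<le> e * h^2 * (2 * norm u + norm v)"
proof -
  define Gu where "Gu = (\<lambda>x. frechet_derivative g (at x) u)"
  define L where "L = frechet_derivative Gu (at q)"
  have "(Gu has_derivative L) (at q)"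
    using du unfolding Gu_def L_def by (simp add: frechet_derivative_works)
  then have linL: "linear L"
    and "\<exists>d1>0. \<forall>y. norm (y - q) < d1 \<longrightarrow> norm (Gu y - Gu q - L (y - q)) \<le> e * norm (y - q)"
    using e unfolding has_derivative_at_alt by (auto intro: bounded_linear.linear)
  then obtain d1 where d1: "d1 > 0"
    and lin_approx: "\<And>y. norm (y - q) < d1 \<Longrightarrow> norm (Gu y - Gu q - L (y - q)) \<le> e * norm (y - q)"
    by blast
  obtain r where r: "r > 0" "ball q r \<subseteq> S" using S open_contains_ball by blast
  define d where "d = min d1 r / (norm u + norm v + 1)"
  have np: "norm u + norm v + 1 > 0" using norm_ge_zero[of u] norm_ge_zero[of v] by linarith
  have "\<bar>(g (q + h *\<^sub>R u + h *\<^sub>R v) - g (q + h *\<^sub>R u) - g (q + h *\<^sub>R v) + g q) - h^2 * L v\<bar>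
          \<le> e * h^2 * (2 * norm u + norm v)" if h: "0 < h" "h < d" for h
  proof -
    have "h * norm u + h * norm v \<le> h * (norm u + norm v + 1)"
      using h by (simp add: algebra_simps)
    also have "\<dots> < d * (norm u + norm v + 1)"
      using h np by (intro mult_strict_right_mono) auto
    finally have hd: "h * norm u + h * norm v < min d1 r" unfolding d_def using np by simp
    then have "h * norm u + h * norm v < r" by simp
    moreover have "g differentiable at x" if "x \<in> ball q r" for x
      using r dg that by blast
    ultimately obtain s where s: "s \<in> {0<..<h}"
      and mv: "g (q + h *\<^sub>R u + h *\<^sub>R v) - g (q + h *\<^sub>R u) - g (q + h *\<^sub>R v) + g q
               = h * (Gu (q + s *\<^sub>R u + h *\<^sub>R v) - Gu (q + s *\<^sub>R u + 0 *\<^sub>R v))"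
      using second_difference_mean_value[OF h(1)] unfolding Gu_def by blast
    define y1 where "y1 = q + s *\<^sub>R u + h *\<^sub>R v"
    define y2 where "y2 = q + s *\<^sub>R u + 0 *\<^sub>R v"
    have n1: "norm (y1 - q) \<le> h * norm u + h * norm v"
      using norm_scaleR_add_le[of s h h u v] s h unfolding y1_def by (simp add: algebra_simps)
    have n2: "norm (y2 - q) \<le> h * norm u"
      using s unfolding y2_def by (simp add: mult_right_mono)
    have "0 \<le> h * norm v" using h by simp
    then have "norm (y1 - q) < d1" "norm (y2 - q) < d1" using n1 n2 hd by linarith+
    from linear_approx_difference[OF linL lin_approx this]
    have "\<bar>(Gu y1 - Gu y2) - h * L v\<bar> \<le> e * norm (y1 - q) + e * norm (y2 - q)"
      using linL unfolding y1_def y2_def by (simp add: linear_scale)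
    also have "\<dots> \<le> e * (h * norm u + h * norm v) + e * (h * norm u)"
      using n1 n2 e by (intro add_mono mult_left_mono) auto
    also have "\<dots> = e * h * (2 * norm u + norm v)"
      by (simp add: algebra_simps)
    finally have estimate: "\<bar>(Gu y1 - Gu y2) - h * L v\<bar> \<le> e * h * (2 * norm u + norm v)" .
    have "(g (q + h *\<^sub>R u + h *\<^sub>R v) - g (q + h *\<^sub>R u) - g (q + h *\<^sub>R v) + g q) - h^2 * L v
        = h * ((Gu y1 - Gu y2) - h * L v)"
      using mv unfolding y1_def y2_def by (simp add: power2_eq_square algebra_simps)
    also have "\<bar>\<dots>\<bar> \<le> h * (e * h * (2 * norm u + norm v))"
      using estimate h by (simp add: abs_mult mult_left_mono)
    finally show ?thesis by (simp add: power2_eq_square algebra_simps)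
  qed
  moreover have "d > 0" using d1 r np unfolding d_def by simp
  ultimately show ?thesis unfolding L_def Gu_def by blast
qed

lemma frechet_derivative_commute:
  fixes g :: "'a::real_normed_vector \<Rightarrow> real"
  assumes S: "open S" "q \<in> S" and dg: "\<And>x. x \<in> S \<Longrightarrow> g differentiable at x"
    and du: "(\<lambda>x. frechet_derivative g (at x) u) differentiable at q"
    and dv: "(\<lambda>x. frechet_derivative g (at x) v) differentiable at q"
  shows "frechet_derivative (\<lambda>x. frechet_derivative g (at x) u) (at q) v
       = frechet_derivative (\<lambda>x. frechet_derivative g (at x) v) (at q) u"
proof -
  define A where "A = frechet_derivative (\<lambda>x. frechet_derivative g (at x) u) (at q) v"
  define B where "B = frechet_derivative (\<lambda>x. frechet_derivative g (at x) v) (at q) u"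
  define C where "C = 2 * norm u + norm v + 2 * norm v + norm u + 1"
  have Cpos: "C > 0" using norm_ge_zero[of u] norm_ge_zero[of v] unfolding C_def by linarith
  define D where "D = (\<lambda>h. g (q + h *\<^sub>R u + h *\<^sub>R v) - g (q + h *\<^sub>R u) - g (q + h *\<^sub>R v) + g q)"
  have "\<bar>A - B\<bar> \<le> e * C" if e: "e > 0" for e
  proof -
    obtain d1 where d1: "d1 > 0" "\<And>h. 0 < h \<and> h < d1 \<Longrightarrow> \<bar>D h - h^2 * A\<bar> \<le> e * h^2 * (2 * norm u + norm v)"
      using second_difference_approx[OF S dg du e, of v] unfolding A_def D_def by blast
    obtain d2 where d2: "d2 > 0" "\<And>h. 0 < h \<and> h < d2 \<Longrightarrow> \<bar>D h - h^2 * B\<bar> \<le> e * h^2 * (2 * norm v + norm u)"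
      using second_difference_approx[OF S dg dv e, of u] unfolding B_def D_def by (auto simp: algebra_simps)
    define h where "h = min d1 d2 / 2"
    have h: "0 < h" "h < d1" "h < d2" using d1 d2 unfolding h_def by auto
    have "h^2 * \<bar>A - B\<bar> = \<bar>(D h - h^2 * B) - (D h - h^2 * A)\<bar>"
    proof -
      have "(D h - h^2 * B) - (D h - h^2 * A) = h^2 * (A - B)" by (simp add: algebra_simps)
      then show ?thesis by (simp add: abs_mult)
    qed
    also have "\<dots> \<le> \<bar>D h - h^2 * B\<bar> + \<bar>D h - h^2 * A\<bar>" by (rule abs_triangle_ineq4)
    also have "\<dots> \<le> e * h^2 * (2 * norm v + norm u) + e * h^2 * (2 * norm u + norm v)"
      using d1(2)[of h] d2(2)[of h] h by (intro add_mono) auto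
    also have "\<dots> \<le> h^2 * (e * C)" unfolding C_def using e by (simp add: algebra_simps)
    finally show ?thesis using h by simp
  qed
  then have le: "\<bar>A - B\<bar> \<le> 0 + x" if "x > 0" for x
    using \<open>\<And>e. e > 0 \<Longrightarrow> \<bar>A - B\<bar> \<le> e * C\<close>[of "x / C"] Cpos that by simp
  have "\<bar>A - B\<bar> \<le> 0" by (rule field_le_epsilon) (rule le)
  then have "\<bar>A - B\<bar> = 0" by simp
  then show ?thesis unfolding A_def B_def by simp
qed

lemma frechet_derivative_commute_within_open:
  fixes g :: "'a::real_normed_vector \<Rightarrow> real"
  assumes S: "open S" "q \<in> S" and dg: "\<And>x. x \<in> S \<Longrightarrow> g differentiable at x"
    and Gu: "\<And>x. x \<in> S \<Longrightarrow> frechet_derivative g (at x) u = Gu x"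
    and Gv: "\<And>x. x \<in> S \<Longrightarrow> frechet_derivative g (at x) v = Gv x"
    and du: "Gu differentiable at q" and dv: "Gv differentiable at q"
  shows "frechet_derivative Gu (at q) v = frechet_derivative Gv (at q) u"
proof -
  have e1: "frechet_derivative Gu (at q) = frechet_derivative (\<lambda>x. frechet_derivative g (at x) u) (at q)"
    by (rule frechet_derivative_transform_within_open[OF du S]) (simp add: Gu)
  have e2: "frechet_derivative Gv (at q) = frechet_derivative (\<lambda>x. frechet_derivative g (at x) v) (at q)"
    by (rule frechet_derivative_transform_within_open[OF dv S]) (simp add: Gv)
  have d1: "(\<lambda>x. frechet_derivative g (at x) u) differentiable at q"
    using du S Gu unfolding differentiable_def by (metis has_derivative_transform_within_open)
  have d2: "(\<lambda>x. frechet_derivative g (at x) v) differentiable at q"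
    using dv S Gv unfolding differentiable_def by (metis has_derivative_transform_within_open)
  show ?thesis unfolding e1 e2 by (rule frechet_derivative_commute[OF S dg d1 d2])
qed

section \<open>Partial derivatives\<close>

lemma smooth_on_imp_C2:
  assumes "smooth_on S F" "open S" "x \<in> S"
  shows "F differentiable at x" "(\<lambda>y. frechet_derivative F (at y) v) differentiable at x"
proof -
  have "Ck_on 2 S F" using assms(1) unfolding smooth_on_def by blast
  then have "F differentiable_on S" "(\<lambda>y. frechet_derivative F (at y) v) differentiable_on S"
    by (simp_all add: numeral_2_eq_2)
  then show "F differentiable at x" "(\<lambda>y. frechet_derivative F (at y) v) differentiable at x"
    using assms(2,3) differentiable_on_eq_differentiable_at by blast+
qed

lemma frechet_derivative_translate:
  assumes "\<And>y. g (y + c) = g y"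
  shows "frechet_derivative g (at (x + c)) = frechet_derivative g (at x)"
proof -
  have "(g has_derivative D) (at (x + c)) \<longleftrightarrow> (g has_derivative D) (at x)" for D
  proof
    assume "(g has_derivative D) (at (x + c))"
    moreover have "((\<lambda>y. y + c) has_derivative (\<lambda>y. y)) (at x)"
      by (auto intro!: derivative_eq_intros)
    ultimately have "((\<lambda>y. g (y + c)) has_derivative D) (at x)"
      using has_derivative_compose[of "\<lambda>y. y + c" "\<lambda>y. y" x UNIV g D] by (simp add: o_def)
    then show "(g has_derivative D) (at x)" using assms by simp
  next
    assume "(g has_derivative D) (at x)"
    moreover have "((\<lambda>y. y - c) has_derivative (\<lambda>y. y)) (at (x + c))"
      by (auto intro!: derivative_eq_intros)
    ultimately have "((\<lambda>y. g (y - c)) has_derivative D) (at (x + c))"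
      using has_derivative_compose[of "\<lambda>y. y - c" "\<lambda>y. y" "x + c" UNIV g D] by (simp add: o_def)
    moreover have "g (y - c) = g y" for y using assms[of "y - c"] by simp
    ultimately show "(g has_derivative D) (at (x + c))" by simp
  qed
  then show ?thesis unfolding frechet_derivative_def by simp
qed

lemma frechet_derivative_eq_0_if_constant_on_line:
  assumes "g differentiable at p" "\<And>s. g (p + s *\<^sub>R v) = g p"
  shows "frechet_derivative g (at p) v = (0::real)"
proof -
  have gd: "(g has_derivative frechet_derivative g (at p)) (at (p + 0 *\<^sub>R v))"
    using assms(1) unfolding frechet_derivative_works by simp
  have line: "((\<lambda>s. p + s *\<^sub>R v) has_derivative (\<lambda>s. s *\<^sub>R v)) (at 0)"
    by (auto intro!: derivative_eq_intros)
  have "((\<lambda>s. g (p + s *\<^sub>R v)) has_derivative (\<lambda>s. frechet_derivative g (at p) (s *\<^sub>R v))) (at 0)"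
    using has_derivative_compose[OF line gd] by (simp add: o_def)
  moreover have "((\<lambda>s. g (p + s *\<^sub>R v)) has_derivative (\<lambda>s. 0)) (at 0)"
    using assms(2) by simp
  ultimately have "(\<lambda>s. frechet_derivative g (at p) (s *\<^sub>R v)) = (\<lambda>s. 0)"
    using has_derivative_unique by blast
  then show ?thesis by (metis scaleR_one)
qed

lemma frechet_derivative_component:
  "F differentiable at x \<Longrightarrow> frechet_derivative (\<lambda>x. F x $ k) (at x) w = frechet_derivative F (at x) w $ k"
  by (metis bounded_linear.has_derivative[OF bounded_linear_vec_nth] frechet_derivative_at
      frechet_derivative_works)

lemma differentiable_component: "F differentiable at x \<Longrightarrow> (\<lambda>x. F x $ k) differentiable at x"
  unfolding differentiable_def using bounded_linear.has_derivative[OF bounded_linear_vec_nth] by blast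

lemma differentiable_divide_const:
  "(g :: 'a::real_normed_vector \<Rightarrow> real) differentiable at x \<Longrightarrow> (\<lambda>x. g x / c) differentiable at x"
  unfolding differentiable_def using bounded_linear.has_derivative[OF bounded_linear_divide] by blast

lemma pd_eqI: "(g has_derivative g') (at p) \<Longrightarrow> pd g p i = g' (axis i 1)"
  unfolding pd_def by (metis frechet_derivative_at)

lemma pd_const: "pd (\<lambda>x. c) p i = 0"
  by (rule pd_eqI) simp

lemma pd_add: "g differentiable at p \<Longrightarrow> h differentiable at p \<Longrightarrow>
  pd (\<lambda>x. g x + h x) p i = pd g p i + pd h p i"
  unfolding pd_def by (rule pd_eqI[unfolded pd_def])
    (auto intro!: derivative_eq_intros simp: frechet_derivative_works)

lemma pd_diff: "g differentiable at p \<Longrightarrow> h differentiable at p \<Longrightarrow>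
  pd (\<lambda>x. g x - h x) p i = pd g p i - pd h p i"
  unfolding pd_def by (rule pd_eqI[unfolded pd_def])
    (auto intro!: derivative_eq_intros simp: frechet_derivative_works)

lemma pd_minus: "g differentiable at p \<Longrightarrow> pd (\<lambda>x. - g x) p i = - pd g p i"
  unfolding pd_def by (rule pd_eqI[unfolded pd_def])
    (auto intro!: derivative_eq_intros simp: frechet_derivative_works)

lemma pd_mult: "(g :: real^'n \<Rightarrow> real) differentiable at p \<Longrightarrow> h differentiable at p \<Longrightarrow>
  pd (\<lambda>x. g x * h x) p i = pd g p i * h p + g p * pd h p i"
  unfolding pd_def
  by (rule pd_eqI[unfolded pd_def], rule has_derivative_eq_rhs,
      (rule derivative_intros | simp add: frechet_derivative_works)+) (auto simp: algebra_simps)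

lemma pd_divide_const: "(g :: real^'n \<Rightarrow> real) differentiable at p \<Longrightarrow>
  pd (\<lambda>x. g x / c) p i = pd g p i / c"
  unfolding pd_def
  by (rule pd_eqI[unfolded pd_def],
      rule bounded_linear.has_derivative[OF bounded_linear_divide], simp add: frechet_derivative_works)

lemmas pd_arith = pd_add pd_diff pd_minus pd_mult pd_divide_const pd_const
  differentiable_add differentiable_diff differentiable_minus differentiable_mult
  differentiable_divide_const differentiable_const

lemma linear_axis_expansion_3:
  fixes L :: "real^3 \<Rightarrow> real"
  assumes "linear L"
  shows "L w = w$1 * L (axis 1 1) + w$2 * L (axis 2 1) + w$3 * L (axis 3 1)"
proof -
  have "L w = L (\<Sum>i\<in>UNIV. (w$i) *s axis i 1)" by (simp add: basis_expansion)
  also have "\<dots> = (\<Sum>i\<in>UNIV. w$i * L (axis i 1))"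
    using assms by (simp add: linear_sum linear_scale scalar_mult_eq_scaleR)
  finally show ?thesis by (simp add: sum_3)
qed

lemma pd_compose_t_independent:
  fixes g :: "real^3 \<Rightarrow> real"
  assumes "X differentiable at x" "g differentiable at (X x)" "pd g (X x) 1 = 0"
  shows "pd (\<lambda>y. g (X y)) x b = pd g (X x) 2 * pd X x b $ 2 + pd g (X x) 3 * pd X x b $ 3"
proof -
  have "pd (\<lambda>y. g (X y)) x b = frechet_derivative g (at (X x)) (pd X x b)"
    unfolding pd_def using frechet_derivative_compose[of X x g] assms(1,2) by (simp add: o_def)
  also have "\<dots> = pd X x b $ 1 * pd g (X x) 1 + pd X x b $ 2 * pd g (X x) 2 + pd X x b $ 3 * pd g (X x) 3"
    unfolding pd_def using assms(2) by (intro linear_axis_expansion_3 linear_frechet_derivative)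
  finally show ?thesis using assms(3) by simp
qed

section \<open>The metric \<open>g\<^sub>f\<^sup>\<epsilon>\<close> and its frame\<close>

definition fx :: "(real^2 \<Rightarrow> real) \<Rightarrow> real^3 \<Rightarrow> real" where
  "fx f p = pd (fxy f) p 2"

definition fy :: "(real^2 \<Rightarrow> real) \<Rightarrow> real^3 \<Rightarrow> real" where
  "fy f p = pd (fxy f) p 3"

lemma fxx_eq_pd_fx: "fxx f p = pd (fx f) p 2"
  by (simp add: fxx_def fx_def[abs_def])

lemma fxy_translate_t: "fxy f (p + s *\<^sub>R axis 1 1) = fxy f p"
  by (simp add: fxy_def axis_def)

lemma ginner_expand: "ginner eps f p a b = eps*a$2*b$2 + fxy f p*a$3*b$3 + a$1*b$3 + a$3*b$1"
  by (simp add: ginner_def gcoef_def sum_3 algebra_simps)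

lemma ginner_commute: "ginner eps f p a b = ginner eps f p b a"
  by (simp add: ginner_expand algebra_simps)

lemma ginner_add_left: "ginner eps f p (a + b) c = ginner eps f p a c + ginner eps f p b c"
  by (simp add: ginner_expand algebra_simps)

lemma ginner_scaleR_left: "ginner eps f p (r *\<^sub>R a) b = r * ginner eps f p a b"
  by (simp add: ginner_expand algebra_simps)

lemma ginner_add_right: "ginner eps f p a (b + c) = ginner eps f p a b + ginner eps f p a c"
  by (simp add: ginner_expand algebra_simps)

lemma ginner_scaleR_right: "ginner eps f p a (r *\<^sub>R b) = r * ginner eps f p a b"
  by (simp add: ginner_expand algebra_simps)

lemma ginner_sum_left: "ginner eps f p (\<Sum>i\<in>I. a i) b = (\<Sum>i\<in>I. ginner eps f p (a i) b)"
  by (simp add: ginner_expand sum_distrib_left sum_distrib_right sum.distrib)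

lemma ginner_frame:
  "ginner eps f p fe1 fe1 = eps" "ginner eps f p (fe2 f p) (fe2 f p) = 1"
  "ginner eps f p (fe3 f p) (fe3 f p) = -1" "ginner eps f p fe1 (fe2 f p) = 0"
  "ginner eps f p fe1 (fe3 f p) = 0" "ginner eps f p (fe2 f p) (fe3 f p) = 0"
  by (simp_all add: ginner_expand fe1_def fe2_def fe3_def field_simps)

lemma ginner_frame_combination:
  assumes "W = a *\<^sub>R fe1 + b *\<^sub>R fe2 f p + c *\<^sub>R fe3 f p"
  shows "ginner eps f p W W = eps * a^2 + b^2 - c^2" and "ginner eps f p W fe1 = eps * a"
    and "ginner eps f p W (fe2 f p) = b" and "ginner eps f p W (fe3 f p) = - c"
  unfolding assms ginner_add_left ginner_scaleR_left ginner_add_right ginner_scaleR_right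
  by (simp_all add: ginner_frame ginner_commute[of eps f p _ fe1]
      ginner_commute[of eps f p "fe3 f p" "fe2 f p"] power2_eq_square)

lemma frame_field_differentiable:
  assumes U: "open U" "q \<in> U"
    and V: "\<And>x. x \<in> U \<Longrightarrow> V x = v1 x *\<^sub>R fe1 + v2 x *\<^sub>R fe2 f (X x) + v3 x *\<^sub>R fe3 f (X x)"
    and v: "v1 differentiable at q" "v2 differentiable at q" "v3 differentiable at q"
    and F: "(\<lambda>x. fxy f (X x)) differentiable at q"
  shows "V differentiable at q"
proof -
  have "fe2 f p = ((2 - fxy f p) / (2 * sqrt 2)) *\<^sub>R axis 1 1 + (1 / sqrt 2) *\<^sub>R axis 3 1"
    and "fe3 f p = ((2 + fxy f p) / (2 * sqrt 2)) *\<^sub>R axis 1 1 + (- 1 / sqrt 2) *\<^sub>R axis 3 1" for p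
    by (simp_all add: fe2_def fe3_def vec_eq_iff forall_3 axis_def)
  moreover have "(\<lambda>x. (2 - fxy f (X x)) / (2 * sqrt 2)) differentiable at q"
    and "(\<lambda>x. (2 + fxy f (X x)) / (2 * sqrt 2)) differentiable at q"
    by (intro differentiable_divide_const differentiable_diff differentiable_add differentiable_const F)+
  ultimately have "(\<lambda>x. v1 x *\<^sub>R fe1 + v2 x *\<^sub>R fe2 f (X x) + v3 x *\<^sub>R fe3 f (X x)) differentiable at q"
    using v by (simp only:) (intro differentiable_add differentiable_scaleR differentiable_const; assumption)
  then obtain D where "((\<lambda>x. v1 x *\<^sub>R fe1 + v2 x *\<^sub>R fe2 f (X x) + v3 x *\<^sub>R fe3 f (X x))
      has_derivative D) (at q)"
    unfolding differentiable_def by blast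
  then have "(V has_derivative D) (at q)"
    by (rule has_derivative_transform_within_open[OF _ U]) (simp add: V)
  then show ?thesis unfolding differentiable_def by blast
qed

lemma matrix_inv_unique:
  fixes A :: "'a::comm_ring_1^'n^'n"
  assumes "A ** B = mat 1" "B ** A = mat 1"
  shows "matrix_inv A = B"
proof -
  have "\<exists>A'. A ** A' = mat 1 \<and> A' ** A = mat 1" using assms by blast
  then have h: "matrix_inv A ** A = mat 1"
    unfolding matrix_inv_def by (rule someI2_ex) blast
  have "matrix_inv A = matrix_inv A ** (A ** B)" using assms by (simp add: matrix_mul_rid)
  also have "\<dots> = B" using h by (simp add: matrix_mul_assoc matrix_mul_lid)
  finally show ?thesis .
qed

lemma matrix_mul_matrix_inv:
  fixes A :: "'a::comm_ring_1^'n^'n"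
  assumes "invertible A"
  shows "A ** matrix_inv A = mat 1"
  using assms unfolding invertible_def matrix_inv_def by (rule someI2_ex) blast

lemma matrix_inv_gmat:
  "eps \<noteq> 0 \<Longrightarrow> matrix_inv (gmat eps f p) =
     (\<chi> i j. if i = 1 \<and> j = 1 then - fxy f p else if i = 2 \<and> j = 2 then 1 / eps
             else if (i = 1 \<and> j = 3) \<or> (i = 3 \<and> j = 1) then 1 else 0)"
  by (rule matrix_inv_unique)
    (simp_all add: matrix_matrix_mult_def gmat_def gcoef_def mat_def vec_eq_iff forall_3 sum_3)

lemma pd_gcoef: "pd (\<lambda>p. gcoef eps f p j l) p i = (if j = 3 \<and> l = 3 then pd (fxy f) p i else 0)"
proof (cases "j = 3 \<and> l = 3")
  case True
  then have "(\<lambda>p. gcoef eps f p j l) = fxy f" by (auto simp: gcoef_def fun_eq_iff)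
  then show ?thesis using True by simp
next
  case False
  then have "(\<lambda>p. gcoef eps f p j l) = (\<lambda>_. gcoef eps f p j l)" by (auto simp: gcoef_def fun_eq_iff)
  then show ?thesis using False by (auto simp: pd_const)
qed

text \<open>\<open>\<Gamma>(Y, W)\<^sup>k = \<Sigma>\<^sub>i\<^sub>j \<Gamma>\<^sup>k\<^sub>i\<^sub>j Y\<^sup>i W\<^sup>j\<close> for \<open>g\<^sub>f\<^sup>\<epsilon>\<close>, in terms of \<open>a = f\<^sub>x\<close> and \<open>b = f\<^sub>y\<close>;
  valid where \<open>f\<^sub>t = 0\<close>.\<close>
definition christoffel_form :: "real \<Rightarrow> real \<Rightarrow> real \<Rightarrow> real^3 \<Rightarrow> real^3 \<Rightarrow> real^3" where
  "christoffel_form eps a b Y W =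
     vector [a/2 * (Y$2*W$3 + Y$3*W$2) + b/2 * Y$3*W$3, - (a/(2*eps)) * Y$3*W$3, 0]"

lemma christoffel_contraction:
  assumes "eps \<noteq> 0" "pd (fxy f) p 1 = 0"
  shows "(\<chi> k. \<Sum>i\<in>UNIV. \<Sum>j\<in>UNIV. christoffel eps f p k i j * Y$i * W$j)
     = christoffel_form eps (fx f p) (fy f p) Y W"
  using assms
  by (simp add: christoffel_def matrix_inv_gmat pd_gcoef christoffel_form_def fx_def fy_def
      vec_eq_iff forall_3 sum_3 field_simps)

section \<open>Gradients on a non-degenerate surface\<close>

lemma sgrad_inner_pd:
  assumes "nondegenerate_at eps f X q"
  shows "ginner eps f (X q) (sgrad eps f X lam q) (pd X q a) = pd lam q a"
proof -
  define G where "G = indmat eps f X q"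
  have "det G \<noteq> 0" using assms unfolding nondegenerate_at_def G_def by auto
  then have inv: "G ** matrix_inv G = mat 1"
    by (simp add: invertible_det_nz matrix_mul_matrix_inv)
  have "ginner eps f (X q) (sgrad eps f X lam q) (pd X q a)
      = (\<Sum>c\<in>UNIV. (G ** matrix_inv G) $ a $ c * pd lam q c)"
    unfolding sgrad_def G_def[symmetric] ginner_sum_left ginner_scaleR_left
    by (simp add: matrix_matrix_mult_def sum_2 G_def indmat_def
        ginner_commute[of eps f "X q" _ "pd X q a"] algebra_simps)
  also have "\<dots> = pd lam q a"
    unfolding inv using exhaust_2[of a] by (auto simp: mat_def sum_2)
  finally show ?thesis .
qed

lemma sgrad_inner_normal:
  assumes "\<forall>w. ginner eps f (X q) W (frechet_derivative X (at q) w) = 0"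
  shows "ginner eps f (X q) (sgrad eps f X lam q) W = 0"
  using assms unfolding sgrad_def ginner_sum_left ginner_scaleR_left pd_def
  by (simp add: ginner_commute)

lemma span_tangent_normal:
  fixes A B W e :: "real^3"
  assumes indep: "\<And>x1 x2. x1 *\<^sub>R A + x2 *\<^sub>R B = 0 \<Longrightarrow> x1 = 0 \<and> x2 = 0"
    and nA: "ginner eps f p W A = 0" and nB: "ginner eps f p W B = 0"
    and WW: "ginner eps f p W W \<noteq> 0"
  obtains x1 x2 x3 where "e = x1 *\<^sub>R A + x2 *\<^sub>R B + x3 *\<^sub>R W"
proof -
  define M :: "real^3^3" where "M = (\<chi> i j. if j = 1 then A$i else if j = 2 then B$i else W$i)"
  have Mv: "M *v x = x$1 *\<^sub>R A + x$2 *\<^sub>R B + x$3 *\<^sub>R W" for x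
    unfolding M_def by (simp add: matrix_vector_mult_def vec_eq_iff sum_3 algebra_simps)
  have "x = y" if "M *v x = M *v y" for x y
  proof -
    define z where "z = x - y"
    have z: "z$1 *\<^sub>R A + z$2 *\<^sub>R B + z$3 *\<^sub>R W = 0"
      using that unfolding z_def Mv[symmetric] by (simp add: matrix_vector_mult_diff_distrib)
    then have "ginner eps f p W (z$1 *\<^sub>R A + z$2 *\<^sub>R B + z$3 *\<^sub>R W) = 0"
      by (simp add: ginner_expand)
    then have z3: "z$3 = 0"
      using nA nB WW by (simp add: ginner_add_right ginner_scaleR_right)
    with z have "z$1 *\<^sub>R A + z$2 *\<^sub>R B = 0" by simp
    then have "z$1 = 0 \<and> z$2 = 0" by (rule indep)
    with z3 show ?thesis unfolding z_def by (simp add: vec_eq_iff forall_3)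
  qed
  then have "inj ((*v) M)" by (rule injI)
  then have "surj ((*v) M)"
    using linear_injective_imp_surjective matrix_vector_mul_linear by blast
  then obtain x where "e = M *v x" by (metis surjD)
  then show ?thesis using that unfolding Mv by blast
qed

lemma inner_eq_tangential_projection:
  fixes A B W S e :: "real^3"
  assumes indep: "\<And>x1 x2. x1 *\<^sub>R A + x2 *\<^sub>R B = 0 \<Longrightarrow> x1 = 0 \<and> x2 = 0"
    and nA: "ginner eps f p W A = 0" and nB: "ginner eps f p W B = 0"
    and WW: "ginner eps f p W W = delta" and delta: "delta * delta = 1"
    and SA: "ginner eps f p S A = c * W$3 * A$3" and SB: "ginner eps f p S B = c * W$3 * B$3"
    and SW: "ginner eps f p S W = 0"
  shows "ginner eps f p S e = c * W$3 * (e$3 - delta * W$3 * ginner eps f p W e)"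
proof -
  have "ginner eps f p W W \<noteq> 0" using WW delta by auto
  then obtain x1 x2 x3 where e: "e = x1 *\<^sub>R A + x2 *\<^sub>R B + x3 *\<^sub>R W"
    using span_tangent_normal[OF indep nA nB] by blast
  show ?thesis
    unfolding e ginner_add_right ginner_scaleR_right SA SB SW nA nB WW
    using delta by (simp add: algebra_simps)
qed

lemma codazzi_tangential_solution:
  fixes A B W :: "real^3"
  assumes indep: "\<And>x1 x2. x1 *\<^sub>R A + x2 *\<^sub>R B = 0 \<Longrightarrow> x1 = 0 \<and> x2 = 0"
    and eps: "eps \<noteq> 0"
    and nA: "ginner eps f p W A = 0" and nB: "ginner eps f p W B = 0"
    and cod1: "l1 * B$1 - l2 * A$1 = -(1/2) * a * W$2 * (A$2 * B$3 - A$3 * B$2)"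
    and cod2: "l1 * B$2 - l2 * A$2 = (1/(2*eps)) * a * W$3 * (A$2 * B$3 - A$3 * B$2)"
    and cod3: "l1 * B$3 - l2 * A$3 = 0"
  shows "l1 = - a / (2*eps) * W$3 * A$3" and "l2 = - a / (2*eps) * W$3 * B$3"
proof -
  define c where "c = - a / (2*eps)"
  have "W$3 * (A$3 * B$1 - B$3 * A$1) = eps * W$2 * (A$2 * B$3 - A$3 * B$2)"
    using nA nB unfolding ginner_expand by algebra
  then have "(-(l2 - c * W$3 * B$3)) *\<^sub>R A + (l1 - c * W$3 * A$3) *\<^sub>R B = 0"
    using cod1 cod2 cod3 eps unfolding c_def vec_eq_iff forall_3 by (simp add: field_simps) algebra
  then have "-(l2 - c * W$3 * B$3) = 0 \<and> l1 - c * W$3 * A$3 = 0" by (rule indep)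
  then show "l1 = c * W$3 * A$3" and "l2 = c * W$3 * B$3" by auto
qed

lemma frame_gradient_identities:
  fixes F e d y1 y2 y3 k w :: real
  assumes kk: "k * k = 1/2" and w: "w = (y2 - y3) * k"
    and e: "e = 1 \<or> e = -1" and d: "d = 1 \<or> d = -1"
    and u: "e * y1^2 + y2^2 - y3^2 = d"
  shows "- F / (2*e) * w * (0 - d * w * (e * y1)) = d * (F * y1 * (y2 - y3)^2) / 4"
    and "- F / (2*e) * w * (k - d * w * y2) = d * (F * (y3 - y2)) / 4 * (y1^2 + e * y3 * (y2 - y3))"
    and "- F / (2*e) * w * (- k - d * w * (- y3)) = d * (F * (y2 - y3)) / 4 * (y1^2 + e * y2 * (y2 - y3))"
proof -
  have "w * w = (k * k) * (y2 - y3)^2" and "w * k = (k * k) * (y2 - y3)"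
    unfolding w by (simp_all add: power2_eq_square algebra_simps)
  then have ww: "w * w = (y2 - y3)^2 / 2" and wk: "w * k = (y2 - y3) / 2"
    unfolding kk by simp_all
  have e0: "e \<noteq> 0" and e2: "e * e = 1" and c: "- F / (2*e) = - F * e / 2"
    using e by auto
  have r2: "e * (1 - d * y2 * (y2 - y3)) = d * (y1^2 + e * y3 * (y2 - y3))"
   and r3: "e * (1 - d * y3 * (y2 - y3)) = d * (y1^2 + e * y2 * (y2 - y3))"
    using d e u by (auto simp: algebra_simps power2_eq_square)
  show "- F / (2*e) * w * (0 - d * w * (e * y1)) = d * (F * y1 * (y2 - y3)^2) / 4"
    unfolding c using e2 ww by (simp add: algebra_simps)
  show "- F / (2*e) * w * (k - d * w * y2) = d * (F * (y3 - y2)) / 4 * (y1^2 + e * y3 * (y2 - y3))"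
  proof -
    have "- F / (2*e) * w * (k - d * w * y2) = - F / 2 * (e * (w * k - d * (w * w) * y2))"
      unfolding c by (simp add: field_simps)
    also have "\<dots> = - F / 2 * ((y2 - y3) / 2) * (e * (1 - d * y2 * (y2 - y3)))"
      unfolding wk ww by (simp add: field_simps power2_eq_square)
    finally show ?thesis unfolding r2 using e0 by (simp add: field_simps)
  qed
  show "- F / (2*e) * w * (- k - d * w * (- y3)) = d * (F * (y2 - y3)) / 4 * (y1^2 + e * y2 * (y2 - y3))"
  proof -
    have "- F / (2*e) * w * (- k - d * w * (- y3)) = F / 2 * (e * (w * k - d * (w * w) * y3))"
      unfolding c by (simp add: field_simps)
    also have "\<dots> = F / 2 * ((y2 - y3) / 2) * (e * (1 - d * y3 * (y2 - y3)))"
      unfolding wk ww by (simp add: field_simps power2_eq_square)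
    finally show ?thesis unfolding r3 using e0 by (simp add: field_simps)
  qed
qed

section \<open>Totally umbilical patches\<close>

locale umbilical_patch =
  fixes eps delta :: real and f :: "real^2 \<Rightarrow> real" and N :: "(real^3) set"
    and U :: "(real^2) set" and X :: "real^2 \<Rightarrow> real^3"
    and lam :: "real^2 \<Rightarrow> real" and V :: "real^2 \<Rightarrow> real^3"
  assumes eps: "eps = 1 \<or> eps = -1"
    and delta: "delta = 1 \<or> delta = -1"
    and N_open: "open N"
    and f_smooth: "smooth_on N (fxy f)"
    and U_open: "open U"
    and X_smooth: "smooth_on U X"
    and X_in: "X ` U \<subseteq> N"
    and immersion: "\<And>q. q \<in> U \<Longrightarrow> inj (frechet_derivative X (at q))"
    and nondeg: "\<And>q. q \<in> U \<Longrightarrow> nondegenerate_at eps f X q"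
    and V_differentiable: "\<And>q. q \<in> U \<Longrightarrow> V differentiable at q"
    and normal: "\<And>q w. q \<in> U \<Longrightarrow> ginner eps f (X q) (V q) (frechet_derivative X (at q) w) = 0"
    and unit: "\<And>q. q \<in> U \<Longrightarrow> ginner eps f (X q) (V q) (V q) = delta"
    and lam_smooth: "smooth_on U lam"
    and umbilic: "\<And>q w. q \<in> U \<Longrightarrow> - covd eps f X V q w = lam q *\<^sub>R frechet_derivative X (at q) w"
begin

lemma eps_nonzero: "eps \<noteq> 0"
  using eps by auto

lemma X_in_N: "x \<in> U \<Longrightarrow> X x \<in> N"
  using X_in by blast

lemma X_differentiable: "x \<in> U \<Longrightarrow> X differentiable at x"
  using smooth_on_imp_C2(1)[OF X_smooth U_open] .

lemma pd_X_component_differentiable: "x \<in> U \<Longrightarrow> (\<lambda>y. pd X y a $ j) differentiable at x"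
  unfolding pd_def by (intro differentiable_component smooth_on_imp_C2(2)[OF X_smooth U_open])

lemma lam_differentiable: "x \<in> U \<Longrightarrow> lam differentiable at x"
  using smooth_on_imp_C2(1)[OF lam_smooth U_open] .

lemma V_component_differentiable: "x \<in> U \<Longrightarrow> (\<lambda>y. V y $ j) differentiable at x"
  by (intro differentiable_component V_differentiable)

lemma fxy_differentiable:
  assumes "p \<in> N"
  shows "fxy f differentiable at p" "fx f differentiable at p" "fy f differentiable at p"
  using smooth_on_imp_C2[OF f_smooth N_open assms]
  by (simp_all add: fx_def[abs_def] fy_def[abs_def] pd_def)

lemma fx_X_differentiable: "x \<in> U \<Longrightarrow> (\<lambda>y. fx f (X y)) differentiable at x"
  and fy_X_differentiable: "x \<in> U \<Longrightarrow> (\<lambda>y. fy f (X y)) differentiable at x"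
  by (simp_all add: differentiable_compose X_differentiable fxy_differentiable X_in_N)

lemma pd_t_fxy: "p \<in> N \<Longrightarrow> pd (fxy f) p 1 = 0"
  unfolding pd_def
  by (rule frechet_derivative_eq_0_if_constant_on_line) (simp_all add: fxy_differentiable fxy_translate_t)

lemma pd_t_fx: "p \<in> N \<Longrightarrow> pd (fx f) p 1 = 0"
  and pd_t_fy: "p \<in> N \<Longrightarrow> pd (fy f) p 1 = 0"
  unfolding pd_def
  by (rule frechet_derivative_eq_0_if_constant_on_line, simp add: fxy_differentiable,
      simp add: fx_def fy_def pd_def frechet_derivative_translate fxy_translate_t)+

lemma pd_fx_y_eq_pd_fy_x: "p \<in> N \<Longrightarrow> pd (fx f) p 3 = pd (fy f) p 2"
  unfolding fx_def[abs_def] fy_def[abs_def] pd_def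
  by (rule frechet_derivative_commute[OF N_open]) (simp_all add: smooth_on_imp_C2[OF f_smooth N_open])

text \<open>The value of \<open>\<partial>\<^sub>a V\<close> forced by the umbilicity equation \<open>-\<nabla>\<^sub>a V = \<lambda> X\<^sub>a\<close>.\<close>
definition normal_derivative :: "2 \<Rightarrow> real^2 \<Rightarrow> real^3" where
  "normal_derivative a x =
     - (lam x *\<^sub>R pd X x a) - christoffel_form eps (fx f (X x)) (fy f (X x)) (pd X x a) (V x)"

lemma pd_V_eq_normal_derivative:
  assumes x: "x \<in> U"
  shows "pd V x a = normal_derivative a x"
proof -
  have "covd eps f X V x (axis a 1)
      = pd V x a + christoffel_form eps (fx f (X x)) (fy f (X x)) (pd X x a) (V x)"
    using christoffel_contraction[OF eps_nonzero pd_t_fxy[OF X_in_N[OF x]]]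
    unfolding covd_def by (simp add: pd_def)
  then have "pd V x a
      = - (- covd eps f X V x (axis a 1)) - christoffel_form eps (fx f (X x)) (fy f (X x)) (pd X x a) (V x)"
    by simp
  also have "- covd eps f X V x (axis a 1) = lam x *\<^sub>R pd X x a"
    using umbilic[OF x] by (simp add: pd_def)
  finally show ?thesis unfolding normal_derivative_def .
qed

lemma normal_derivative_components:
  "normal_derivative a x $ 1 = - (lam x * pd X x a $ 1)
     - (fx f (X x) / 2 * (pd X x a $ 2 * V x $ 3 + pd X x a $ 3 * V x $ 2)
        + fy f (X x) / 2 * pd X x a $ 3 * V x $ 3)"
  "normal_derivative a x $ 2 = - (lam x * pd X x a $ 2) + fx f (X x) / (2 * eps) * pd X x a $ 3 * V x $ 3"
  "normal_derivative a x $ 3 = - (lam x * pd X x a $ 3)"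
  by (simp_all add: normal_derivative_def christoffel_form_def)

lemma normal_derivative_component_differentiable:
  assumes x: "x \<in> U"
  shows "(\<lambda>y. normal_derivative a y $ j) differentiable at x"
  using exhaust_3[of j] x
  by (auto simp: normal_derivative_components lam_differentiable pd_X_component_differentiable
      V_component_differentiable fx_X_differentiable fy_X_differentiable
      intro!: differentiable_add differentiable_diff differentiable_mult differentiable_minus
      differentiable_divide_const)

lemma mixed_pd_X:
  assumes q: "q \<in> U"
  shows "pd (\<lambda>x. pd X x 1 $ j) q 2 = pd (\<lambda>x. pd X x 2 $ j) q 1"
  unfolding pd_def
  by (rule frechet_derivative_commute_within_open[OF U_open q, where g = "\<lambda>x. X x $ j"])
    (use q pd_X_component_differentiable[unfolded pd_def] in
      \<open>simp_all add: X_differentiable differentiable_component frechet_derivative_component\<close>)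

lemma mixed_pd_normal_derivative:
  assumes q: "q \<in> U"
  shows "pd (\<lambda>x. normal_derivative 1 x $ j) q 2 = pd (\<lambda>x. normal_derivative 2 x $ j) q 1"
  unfolding pd_def
  by (rule frechet_derivative_commute_within_open[OF U_open q, where g = "\<lambda>x. V x $ j"])
    (use q normal_derivative_component_differentiable in
      \<open>simp_all add: V_differentiable differentiable_component frechet_derivative_component
        pd_V_eq_normal_derivative[unfolded pd_def]\<close>)

lemma pd_normal_derivative:
  fixes a b :: 2
  assumes q: "q \<in> U"
  defines "Y \<equiv> pd X q a" and "Y' \<equiv> \<lambda>j. pd (\<lambda>x. pd X x a $ j) q b"
    and "W \<equiv> V q" and "W' \<equiv> normal_derivative b q" and "l \<equiv> pd lam q b"
    and "Dfx \<equiv> pd (fx f) (X q) 2 * pd X q b $ 2 + pd (fx f) (X q) 3 * pd X q b $ 3"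
    and "Dfy \<equiv> pd (fx f) (X q) 3 * pd X q b $ 2 + pd (fy f) (X q) 3 * pd X q b $ 3"
  shows "pd (\<lambda>x. normal_derivative a x $ 1) q b = - (l * Y$1 + lam q * Y' 1)
           - (Dfx / 2 * (Y$2 * W$3 + Y$3 * W$2)
              + fx f (X q) / 2 * (Y' 2 * W$3 + Y$2 * W'$3 + Y' 3 * W$2 + Y$3 * W'$2)
              + Dfy / 2 * Y$3 * W$3 + fy f (X q) / 2 * (Y' 3 * W$3 + Y$3 * W'$3))"
    and "pd (\<lambda>x. normal_derivative a x $ 2) q b = - (l * Y$2 + lam q * Y' 2)
           + (Dfx / (2 * eps) * Y$3 * W$3 + fx f (X q) / (2 * eps) * (Y' 3 * W$3 + Y$3 * W'$3))"
    and "pd (\<lambda>x. normal_derivative a x $ 3) q b = - (l * Y$3 + lam q * Y' 3)"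
proof -
  have XN: "X q \<in> N" using X_in_N[OF q] .
  have pdV: "pd (\<lambda>x. V x $ j) q b = W' $ j" for j
    unfolding W'_def pd_V_eq_normal_derivative[OF q, symmetric] pd_def
    using frechet_derivative_component[OF V_differentiable[OF q]] by simp
  have pdfx: "pd (\<lambda>x. fx f (X x)) q b = Dfx"
    unfolding Dfx_def
    by (rule pd_compose_t_independent) (simp_all add: X_differentiable q fxy_differentiable XN pd_t_fx)
  have pdfy: "pd (\<lambda>x. fy f (X x)) q b = Dfy"
    unfolding Dfy_def pd_fx_y_eq_pd_fy_x[OF XN]
    by (rule pd_compose_t_independent) (simp_all add: X_differentiable q fxy_differentiable XN pd_t_fy)
  note atoms = lam_differentiable[OF q] pd_X_component_differentiable[OF q]
    V_component_differentiable[OF q] fx_X_differentiable[OF q] fy_X_differentiable[OF q]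
  show "pd (\<lambda>x. normal_derivative a x $ 1) q b = - (l * Y$1 + lam q * Y' 1)
           - (Dfx / 2 * (Y$2 * W$3 + Y$3 * W$2)
              + fx f (X q) / 2 * (Y' 2 * W$3 + Y$2 * W'$3 + Y' 3 * W$2 + Y$3 * W'$2)
              + Dfy / 2 * Y$3 * W$3 + fy f (X q) / 2 * (Y' 3 * W$3 + Y$3 * W'$3))"
    unfolding normal_derivative_components
    using atoms by (simp only: pd_arith) (simp add: pdV pdfx pdfy Y_def Y'_def W_def l_def algebra_simps)
  show "pd (\<lambda>x. normal_derivative a x $ 2) q b = - (l * Y$2 + lam q * Y' 2)
           + (Dfx / (2 * eps) * Y$3 * W$3 + fx f (X q) / (2 * eps) * (Y' 3 * W$3 + Y$3 * W'$3))"
    unfolding normal_derivative_components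
    using atoms by (simp only: pd_arith) (simp add: pdV pdfx pdfy Y_def Y'_def W_def l_def algebra_simps)
  show "pd (\<lambda>x. normal_derivative a x $ 3) q b = - (l * Y$3 + lam q * Y' 3)"
    unfolding normal_derivative_components
    using atoms by (simp only: pd_arith) (simp add: Y_def Y'_def l_def)
qed

lemma codazzi:
  assumes q: "q \<in> U"
  defines "A \<equiv> pd X q 1" and "B \<equiv> pd X q 2" and "W \<equiv> V q"
    and "J \<equiv> pd X q 1 $ 2 * pd X q 2 $ 3 - pd X q 1 $ 3 * pd X q 2 $ 2"
  shows "pd lam q 1 * B$1 - pd lam q 2 * A$1 = -(1/2) * fxx f (X q) * W$2 * J"
    and "pd lam q 1 * B$2 - pd lam q 2 * A$2 = (1/(2*eps)) * fxx f (X q) * W$3 * J"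
    and "pd lam q 1 * B$3 - pd lam q 2 * A$3 = 0"
proof -
  define l0 l1 l2 where "l0 = lam q" and "l1 = pd lam q 1" and "l2 = pd lam q 2"
  define a b where "a = fx f (X q)" and "b = fy f (X q)"
  define fxx' fxy' fyy' where "fxx' = pd (fx f) (X q) 2" and "fxy' = pd (fx f) (X q) 3"
    and "fyy' = pd (fy f) (X q) 3"
  define X12 where "X12 j = pd (\<lambda>x. pd X x 2 $ j) q 1" for j
  have sym: "pd (\<lambda>x. normal_derivative 1 x $ j) q 2 = pd (\<lambda>x. normal_derivative 2 x $ j) q 1" for j
    by (rule mixed_pd_normal_derivative[OF q])
  note expand = pd_normal_derivative[OF q, of 1 2] pd_normal_derivative[OF q, of 2 1]
  \<comment> \<open>Naming the atoms keeps the polynomial normalisation below fast.\<close>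
  note fold = fxx_eq_pd_fx A_def[symmetric] B_def[symmetric] W_def[symmetric] l0_def[symmetric]
    l1_def[symmetric] l2_def[symmetric] a_def[symmetric] b_def[symmetric] fxx'_def[symmetric]
    fxy'_def[symmetric] fyy'_def[symmetric] X12_def[symmetric]
  note codazzi_component = sym[of 1] sym[of 2] sym[of 3]
  note codazzi_component = codazzi_component[unfolded expand,
    unfolded normal_derivative_components mixed_pd_X[OF q] fold]
  show "pd lam q 1 * B$1 - pd lam q 2 * A$1 = -(1/2) * fxx f (X q) * W$2 * J"
    using codazzi_component(1) unfolding J_def fold
    by (simp add: algebra_simps, (simp add: field_simps)?)
  show "pd lam q 1 * B$2 - pd lam q 2 * A$2 = (1/(2*eps)) * fxx f (X q) * W$3 * J"
    using codazzi_component(2) eps_nonzero unfolding J_def fold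
    by (simp add: algebra_simps, (simp add: field_simps)?)
  show "pd lam q 1 * B$3 - pd lam q 2 * A$3 = 0"
    using codazzi_component(3) unfolding fold by (simp add: algebra_simps)
qed

lemma pd_X_independent:
  assumes q: "q \<in> U" and comb: "x1 *\<^sub>R pd X q 1 + x2 *\<^sub>R pd X q 2 = 0"
  shows "x1 = 0 \<and> x2 = 0"
proof -
  have "frechet_derivative X (at q) (x1 *\<^sub>R axis 1 1 + x2 *\<^sub>R axis 2 1) = frechet_derivative X (at q) 0"
    using comb linear_frechet_derivative[OF X_differentiable[OF q]]
    unfolding pd_def by (simp add: linear_add linear_scale linear_0)
  then have "x1 *\<^sub>R axis 1 1 + x2 *\<^sub>R axis 2 1 = (0::real^2)"
    using immersion[OF q] by (meson injD)
  then have "(x1 *\<^sub>R axis 1 1 + x2 *\<^sub>R axis 2 1 :: real^2) $ 1 = 0"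
    "(x1 *\<^sub>R axis 1 1 + x2 *\<^sub>R axis 2 1 :: real^2) $ 2 = 0" by simp_all
  then show ?thesis by (simp add: axis_def)
qed

lemma pd_lam_eq:
  assumes q: "q \<in> U"
  shows "pd lam q a = - fxx f (X q) / (2 * eps) * V q $ 3 * pd X q a $ 3"
proof -
  have n: "ginner eps f (X q) (V q) (pd X q a) = 0" for a
    using normal[OF q] unfolding pd_def .
  show ?thesis
    using codazzi_tangential_solution[OF pd_X_independent[OF q] eps_nonzero n n codazzi[OF q]]
      exhaust_2[of a] by auto
qed

lemma gradient_lambda_inner:
  assumes q: "q \<in> U"
  shows "ginner eps f (X q) (sgrad eps f X lam q) e
    = - fxx f (X q) / (2 * eps) * V q $ 3 * (e $ 3 - delta * V q $ 3 * ginner eps f (X q) (V q) e)"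
proof -
  have tangent: "ginner eps f (X q) (V q) (pd X q a) = 0" for a
    using normal[OF q] unfolding pd_def .
  have grad_tangent: "ginner eps f (X q) (sgrad eps f X lam q) (pd X q a)
      = - fxx f (X q) / (2 * eps) * V q $ 3 * pd X q a $ 3" for a
    using sgrad_inner_pd[OF nondeg[OF q]] pd_lam_eq[OF q] by simp
  have grad_normal: "ginner eps f (X q) (sgrad eps f X lam q) (V q) = 0"
    using normal[OF q] by (intro sgrad_inner_normal) blast
  have "delta * delta = 1" using delta by auto
  from inner_eq_tangential_projection[OF pd_X_independent[OF q] tangent tangent unit[OF q] this
          grad_tangent grad_tangent grad_normal]
  show ?thesis .
qed

lemma gradient_lambda_frame:
  assumes q: "q \<in> U"
    and frame: "V q = v1 *\<^sub>R fe1 + v2 *\<^sub>R fe2 f (X q) + v3 *\<^sub>R fe3 f (X q)"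
  shows "ginner eps f (X q) (sgrad eps f X lam q) fe1
        = delta * (fxx f (X q) * v1 * (v2 - v3)^2) / 4
   \<and> ginner eps f (X q) (sgrad eps f X lam q) (fe2 f (X q))
        = delta * (fxx f (X q) * (v3 - v2)) / 4 * (v1^2 + eps * v3 * (v2 - v3))
   \<and> ginner eps f (X q) (sgrad eps f X lam q) (fe3 f (X q))
        = delta * (fxx f (X q) * (v2 - v3)) / 4 * (v1^2 + eps * v2 * (v2 - v3))"
proof -
  have k: "1 / sqrt 2 * (1 / sqrt 2) = (1 / 2 :: real)" by simp
  have W3: "V q $ 3 = (v2 - v3) * (1 / sqrt 2)"
    using frame by (simp add: fe1_def fe2_def fe3_def diff_divide_distrib)
  have frame_t: "fe1 $ 3 = 0" "fe2 f (X q) $ 3 = 1 / sqrt 2" "fe3 f (X q) $ 3 = - (1 / sqrt 2)"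
    by (simp_all add: fe1_def fe2_def fe3_def)
  have "eps * v1^2 + v2^2 - v3^2 = delta"
    using unit[OF q] ginner_frame_combination(1)[OF frame] by simp
  from frame_gradient_identities[OF k W3 eps delta this] show ?thesis
    unfolding gradient_lambda_inner[OF q] ginner_frame_combination(2-4)[OF frame] frame_t by simp
qed

end

theorem mainTheorem2:
  fixes eps delta :: real and f :: "real^2 \<Rightarrow> real" and N :: "(real^3) set"
    and U :: "(real^2) set" and X :: "real^2 \<Rightarrow> real^3"
    and v1 v2 v3 lam :: "real^2 \<Rightarrow> real" and V :: "real^2 \<Rightarrow> real^3"
  assumes eps: "eps = 1 \<or> eps = -1"
    and delta: "delta = 1 \<or> delta = -1"
    and N_open: "open N"
    and f_smooth: "smooth_on N (fxy f)"
    and U_open: "open U"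
    and X_smooth: "smooth_on U X"
    and X_in: "X ` U \<subseteq> N"
    and immersion: "\<forall>q\<in>U. inj (frechet_derivative X (at q))"
    and nondeg: "\<forall>q\<in>U. nondegenerate_at eps f X q"
    and v_smooth: "smooth_on U v1" "smooth_on U v2" "smooth_on U v3"
    and V_def: "\<forall>q\<in>U. V q = v1 q *\<^sub>R fe1 + v2 q *\<^sub>R fe2 f (X q) + v3 q *\<^sub>R fe3 f (X q)"
    and normal: "\<forall>q\<in>U. \<forall>w. ginner eps f (X q) (V q) (frechet_derivative X (at q) w) = 0"
    and unit: "\<forall>q\<in>U. eps * (v1 q)^2 + (v2 q)^2 - (v3 q)^2 = delta"
    and v1_nz: "\<forall>q\<in>U. v1 q \<noteq> 0"
    and lam_smooth: "smooth_on U lam"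
    and umbilic: "\<forall>q\<in>U. \<forall>w. - covd eps f X V q w = lam q *\<^sub>R frechet_derivative X (at q) w"
  shows "\<forall>q\<in>U.
     ginner eps f (X q) (sgrad eps f X lam q) fe1
        = delta * (fxx f (X q) * v1 q * (v2 q - v3 q)^2) / 4
   \<and> ginner eps f (X q) (sgrad eps f X lam q) (fe2 f (X q))
        = delta * (fxx f (X q) * (v3 q - v2 q)) / 4 * ((v1 q)^2 + eps * v3 q * (v2 q - v3 q))
   \<and> ginner eps f (X q) (sgrad eps f X lam q) (fe3 f (X q))
        = delta * (fxx f (X q) * (v2 q - v3 q)) / 4 * ((v1 q)^2 + eps * v2 q * (v2 q - v3 q))"
proof -
  have frame: "V x = v1 x *\<^sub>R fe1 + v2 x *\<^sub>R fe2 f (X x) + v3 x *\<^sub>R fe3 f (X x)" if "x \<in> U" for x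
    using V_def that by blast
  interpret surface: umbilical_patch eps delta f N U X lam V
  proof
    show "V differentiable at x" if x: "x \<in> U" for x
    proof (rule frame_field_differentiable[OF U_open x frame])
      show "v1 differentiable at x" "v2 differentiable at x" "v3 differentiable at x"
        using smooth_on_imp_C2(1)[OF _ U_open x] v_smooth by blast+
      show "(\<lambda>x. fxy f (X x)) differentiable at x"
        using differentiable_compose[of "fxy f" X x UNIV] smooth_on_imp_C2(1)[OF f_smooth N_open]
          smooth_on_imp_C2(1)[OF X_smooth U_open x] X_in x by blast
    qed
    show "ginner eps f (X x) (V x) (V x) = delta" if "x \<in> U" for x
      using ginner_frame_combination(1)[OF frame[OF that]] unit that by simp
  qed (simp_all add: eps delta N_open f_smooth U_open X_smooth X_in immersion nondeg normal
      lam_smooth umbilic)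
  show ?thesis
    using surface.gradient_lambda_frame[OF _ frame] by blast
qed

end
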